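(* Let $M$ be a simple binary matroid containing none of $I_3$, $F_7$, $K_5$ as an induced restriction. Then $\chi(M)\le 2$.
   Context: A simple binary matroid (here just "matroid") is a pair $M=(E,G)$, where $G$ is a finite-dimensional binary projective geometry, identified with the set $\mathbb F_2^n\setminus\{0\}$ of nonzero vectors of $\mathbb F_2^n$, and $E\subseteq G$ is the ground set; $\dim(M)=n$. A flat of $G$ is a set $V\setminus\{0\}$ with $V$ a subspace of $\mathbb F_2^n$; its dimension is $\dim V$. For a flat $F$, $M|F=(E\cap F,F)$. $M$ contains $N=(F',G')$ as an induced restriction if there is an injective linear map $\varphi:G'\to G$ (linear on the underlying vector spaces) with $\varphi(F')=E\cap\varphi(G')$; $M\cong N$ if such a $\varphi$ is bijective. The critical number $\chi(M)$ of an $n$-dimensional matroid $M=(E,G)$ is the smallest integer $k\ge 0$ such that $G\setminus E$ contains a flat of dimension $n-k$. $I_3$ is the $3$-dimensional matroid whose ground set consists of $3$ linearly independent vectors; $F_7=(G,G)$ with $G=\mathbb F_2^3\setminus\{0\}$ (the Fano plane); $K_5=(E,G)$ with $G=\mathbb F_2^4\setminus\{0\}$ and $E$ the vectors of Hamming weight $1$ or $2$. *)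

theory Defs
  imports "HOL-Analysis.Analysis" "HOL-Library.Z2"
begin

text \<open>The two-element field is the type \<^typ>\<open>bit\<close>; subspaces, dimension and linear maps are those of
  the library's coordinate spaces (the \<open>vec\<close> interpretation). The geometry of a matroid may be any
  flat of the nonzero vectors of \<open>bit ^ 'n\<close>, not only the set of all of them: then \<open>M | F\<close> lives in the
  same type as \<open>M\<close>, and dimension 0 (the empty geometry) is covered although \<open>'n\<close> is nonempty.\<close>

definition flat :: "(bit ^ 'n) set \<Rightarrow> bool" where
  "flat F \<longleftrightarrow> (\<exists>V. vec.subspace V \<and> F = V - {0})"

definition flat_dim :: "(bit ^ 'n) set \<Rightarrow> nat" where
  "flat_dim F = vec.dim (insert 0 F)"

text \<open>A matroid is a pair \<open>(E, G)\<close> of its ground set and its geometry.\<close>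

type_synonym 'n matroid = "(bit ^ 'n) set \<times> (bit ^ 'n) set"

definition simple_binary_matroid :: "'n::finite matroid \<Rightarrow> bool" where
  "simple_binary_matroid M \<longleftrightarrow> (case M of (E, G) \<Rightarrow> flat G \<and> E \<subseteq> G)"

definition matroid_dim :: "'n::finite matroid \<Rightarrow> nat" where
  "matroid_dim M = flat_dim (snd M)"

text \<open>The map is taken to be linear on the whole coordinate space, which is no restriction because a
  linear map on a subspace extends; injectivity is required only on the subspace underlying \<open>G'\<close>.\<close>

definition contains_induced_restriction :: "'n::finite matroid \<Rightarrow> 'm::finite matroid \<Rightarrow> bool" where
  "contains_induced_restriction M N \<longleftrightarrow>
     (case M of (E, G) \<Rightarrow> case N of (F', G') \<Rightarrow>
       (\<exists>\<phi>. Vector_Spaces.linear (*s) (*s) \<phi> \<and> inj_on \<phi> (insert 0 G') \<and>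
            \<phi> ` G' \<subseteq> G \<and> \<phi> ` F' = E \<inter> \<phi> ` G'))"

text \<open>The condition \<open>dim F = n - k\<close> is written additively to avoid truncated subtraction. The
  set of admissible \<open>k\<close> is nonempty: for \<open>k = n\<close> the empty flat qualifies.\<close>

definition critical_number :: "'n::finite matroid \<Rightarrow> nat" where
  "critical_number M = (case M of (E, G) \<Rightarrow>
     (LEAST k. \<exists>F. flat F \<and> F \<subseteq> G - E \<and> flat_dim F + k = matroid_dim M))"

definition I3 :: "3 matroid" where
  "I3 = (range (\<lambda>i. axis i 1), UNIV - {0})"

definition F7 :: "3 matroid" where
  "F7 = (UNIV - {0}, UNIV - {0})"

definition hamming_weight :: "bit ^ 'n \<Rightarrow> nat" where
  "hamming_weight v = card {i. v $ i \<noteq> 0}"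

definition K5 :: "4 matroid" where
  "K5 = ({v. hamming_weight v = 1 \<or> hamming_weight v = 2}, UNIV - {0})"

end

theory Submission
  imports Defs
begin

text \<open>
  Let \<open>W\<close> be a largest subspace of the geometry that avoids \<open>E\<close>; then \<open>E\<close> meets every other coset of
  \<open>W\<close>. If \<open>W\<close> had codimension at least 3, choose a three-dimensional subspace of the quotient by \<open>W\<close>
  and try to lift it to a Fano plane inside \<open>E\<close>, one point in each of its seven cosets. Excluding
  \<open>I\<^sub>3\<close> gives a lift of one line to \<open>E\<close>, hence a linear lift of the plane with at least four points
  in \<open>E\<close>. Then some linear lift has five points in \<open>E\<close>, on two lines; then some linear lift has six;
  and then there is one with all seven or an induced \<open>K\<^sub>5\<close>.
\<close>

section \<open>Vector arithmetic over the two-element field\<close>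

lemma bit_vec_add_self [simp]: "x + x = 0" for x :: "bit ^ 'n"
  by (simp add: vec_eq_iff)

lemma bit_vec_add_self_left [simp]: "x + (x + y) = y" for x :: "bit ^ 'n"
  by (simp flip: add.assoc)

lemma bit_vec_diff: "x - y = x + y" for x y :: "bit ^ 'n"
  by (simp add: diff_eq_eq add.assoc)

lemma bit_vec_add_eq_0_iff: "x + y = 0 \<longleftrightarrow> x = y" for x y :: "bit ^ 'n"
  by (metis bit_vec_diff right_minus_eq)

lemmas bit_vec_ac = add.assoc add.commute add.left_commute

text \<open>The three exclusion rules need no linear independence: since \<open>0 \<notin> E\<close>, they hold trivially for
  dependent vectors. Hence the lemmas about \<open>u, v, s \<in> W\<close> below need no case
  distinction on linear relations among these elements.\<close>

locale zero_flat =
  fixes E W :: "(bit ^ 'n) set"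
  assumes zero_mem: "0 \<in> W"
    and add_mem: "u \<in> W \<Longrightarrow> v \<in> W \<Longrightarrow> u + v \<in> W"
    and disjnt: "u \<in> W \<Longrightarrow> u \<notin> E"
    and claw: "\<lbrakk>x \<in> E; y \<in> E; z \<in> E\<rbrakk>
      \<Longrightarrow> x + y \<in> E \<or> x + z \<in> E \<or> y + z \<in> E \<or> x + y + z \<in> E"
    and Fano: "\<lbrakk>x \<in> E; y \<in> E; z \<in> E; x + y \<in> E; x + z \<in> E; y + z \<in> E\<rbrakk> \<Longrightarrow> x + y + z \<notin> E"
    and clique: "\<lbrakk>w \<in> E; x \<in> E; y \<in> E; z \<in> E; w + x \<in> E; w + y \<in> E; w + z \<in> E;
        x + y \<in> E; x + z \<in> E; y + z \<in> E\<rbrakk>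
      \<Longrightarrow> w + x + y \<in> E \<or> w + x + z \<in> E \<or> w + y + z \<in> E \<or> x + y + z \<in> E \<or> w + x + y + z \<in> E"
begin

section \<open>Partial lifts of a Fano plane into \<open>E\<close>\<close>

text \<open>The claw rule for \<open>x\<close>, \<open>y\<close>, \<open>x + y + w\<close> has total
  sum \<open>w\<close>, which avoids \<open>E\<close>. Each remaining case puts a line into
  \<open>E\<close> in the same three cosets of \<open>W\<close>, with \<open>x\<close> or
  \<open>y\<close> shifted by \<open>w\<close> if necessary.\<close>

lemma line_in_cosets:
  assumes "x \<in> E" "y \<in> E" "x + y + w \<in> E" "w \<in> W"
  shows "x + y \<in> E \<or> x + w \<in> E \<or> y + w \<in> E"
  using claw [OF assms(1-3)] disjnt [OF assms(4)] by (auto simp: bit_vec_ac)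

lemma no_six_points:
  assumes "x \<in> E" "y \<in> E" "x + y \<in> E" "z \<in> E" "x + z \<in> E" "y + z \<in> E"
    and "x + y + z + s \<in> E" "s \<in> W"
  shows False
proof -
  note E = assms(1-7)
  have s: "s \<notin> E" and xyz: "x + y + z \<notin> E"
    using disjnt assms(8) Fano E by blast+
  \<comment> \<open>Without the shift \<open>s\<close>, the pairs are the three lines through the
    missing point \<open>x + y + z\<close>.\<close>
  have pairs: "x + s \<in> E \<or> y + z + s \<in> E" "y + s \<in> E \<or> x + z + s \<in> E" "z + s \<in> E \<or> x + y + s \<in> E"
    using claw [OF E(1,6,7)] claw [OF E(2,5,7)] claw [OF E(4,3,7)] s xyz
    by (auto simp: bit_vec_ac)
  have planes: "\<not> (z + s \<in> E \<and> x + z + s \<in> E \<and> y + z + s \<in> E)"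
    "\<not> (y + s \<in> E \<and> x + y + s \<in> E \<and> y + z + s \<in> E)"
    "\<not> (x + s \<in> E \<and> x + y + s \<in> E \<and> x + z + s \<in> E)"
    "\<not> (x + s \<in> E \<and> y + s \<in> E \<and> z + s \<in> E)"
    using Fano [of x y "z + s"] Fano [of x z "y + s"] Fano [of y z "x + s"]
      Fano [of "x + y" "x + z" "x + s"] E
    by (auto simp: bit_vec_ac)
  have cliques:
    "x + s \<in> E \<Longrightarrow> y + s \<in> E \<Longrightarrow> x + y + s \<in> E \<Longrightarrow> z + s \<in> E \<or> x + z + s \<in> E \<or> y + z + s \<in> E"
    "x + s \<in> E \<Longrightarrow> z + s \<in> E \<Longrightarrow> x + z + s \<in> E \<Longrightarrow> y + s \<in> E \<or> x + y + s \<in> E \<or> y + z + s \<in> E"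
    "y + s \<in> E \<Longrightarrow> z + s \<in> E \<Longrightarrow> y + z + s \<in> E \<Longrightarrow> x + s \<in> E \<or> x + y + s \<in> E \<or> x + z + s \<in> E"
    "x + y + s \<in> E \<Longrightarrow> x + z + s \<in> E \<Longrightarrow> y + z + s \<in> E \<Longrightarrow> x + s \<in> E \<or> y + s \<in> E \<or> z + s \<in> E"
    using clique [of x y z "x + y + s"] clique [of x y z "x + z + s"] clique [of x y z "y + z + s"]
      clique [of x y z "x + y + z + s"] E s xyz
    by (auto simp: bit_vec_ac)
  \<comment> \<open>Up to the shift, the eight ways to pick one point from each of
    \<open>pairs\<close> are the four lines avoiding the missing point and their complements among
    the six points. \<open>planes\<close> excludes the complements. \<open>cliques\<close> adds a
    further point to a line, and exchanging it with its partner produces such a complement.\<close>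
  show False
    using pairs planes cliques by blast
qed

lemma no_five_points:
  assumes "x \<in> E" "y \<in> E" "x + y \<in> E" "z \<in> E" "x + z \<in> E"
    and "y + z + u \<in> E" "x + y + z + v \<in> E" "u \<in> W" "v \<in> W"
  shows False
proof -
  note E = assms(1-7)
  have uv: "u + v \<in> W" and v: "v \<notin> E"
    using assms add_mem disjnt by auto
  have yz: "y + z \<notin> E" and xyz: "x + y + z \<notin> E"
    using no_six_points [of x y z v] no_six_points [of x "x + y" z u] E assms(8,9)
    by (auto simp: bit_vec_ac)
  \<comment> \<open>Each conjunction would complete six points of another linear lift, whose seventh
    coset meets \<open>E\<close> in \<open>y + z + u\<close>, \<open>x + y\<close> or
    \<open>y\<close>.\<close>
  have sixes: "\<not> (y + v \<in> E \<and> x + y + v \<in> E)" "\<not> (y + v \<in> E \<and> y + z + v \<in> E)"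
    "\<not> (x + y + v \<in> E \<and> y + z + v \<in> E)" "\<not> (z + v \<in> E \<and> x + z + v \<in> E)"
    using no_six_points [of x "x + y + v" z "u + v"] no_six_points [of x z "y + z + v" v]
      no_six_points [of x z "x + y + z + v" v] no_six_points [of x y "x + z + v" "u + v"]
      E assms(8,9) uv
    by (auto simp: bit_vec_ac)
  have claws: "x + v \<in> E \<Longrightarrow> y + z + v \<in> E" "z + v \<in> E \<or> y + v \<in> E \<or> x + v \<in> E"
    "x + z + v \<in> E \<or> y + v \<in> E" "z + v \<in> E \<or> x + y + v \<in> E"
    "z + v \<in> E \<Longrightarrow> y + z + v \<in> E \<or> x + v \<in> E \<or> x + y + v \<in> E"
    using claw [of x "x + v" "x + y + z + v"] claw [of "x + y" "x + z" "x + y + z + v"]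
      claw [of y "x + z" "x + y + z + v"] claw [of "x + y" z "x + y + z + v"]
      claw [of y "x + z" "z + v"] E v yz xyz
    by (auto simp: bit_vec_ac)
  \<comment> \<open>If \<open>z + v \<in> E\<close>, then \<open>y + v \<in> E\<close>; otherwise
    \<open>x + y + v \<in> E\<close>. Both cases force \<open>x + v\<close> and hence
    \<open>y + z + v\<close> into \<open>E\<close>, against \<open>sixes\<close>.\<close>
  show False
    using sixes claws by blast
qed

text \<open>Once every fifth point is excluded, the claw rule forces the line \<open>x + u\<close>,
  \<open>y + v\<close>, \<open>x + y + u + v\<close> into \<open>E\<close>. With the line
  \<open>x + u\<close>, \<open>z\<close>, \<open>x + z + u\<close> it gives five points after
  all.\<close>

lemma no_transversal:
  assumes "x \<in> E" "y \<in> E" "x + y \<in> E" "z \<in> E"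
    and "x + z + u \<in> E" "y + z + v \<in> E" "x + y + z + s \<in> E" "u \<in> W" "v \<in> W" "s \<in> W"
  shows False
proof -
  note E = assms(1-7)
  have W: "u + v \<in> W" "u + s \<in> W" "v + s \<in> W" "u + (v + s) \<in> W"
    using assms(8-10) add_mem by auto
  have "x + z \<notin> E" "y + z \<notin> E"
    using no_five_points [of x y z v s] no_five_points [of y x z u s] E assms(8-10)
    by (auto simp: bit_vec_ac)
  moreover have "z + u \<notin> E" "z + v \<notin> E"
    using no_five_points [of x y "z + u" "u + v" "u + s"]
      no_five_points [of y x "z + v" "u + v" "v + s"] E W
    by (auto simp: bit_vec_ac)
  moreover have "y + z + u \<notin> E" "x + z + v \<notin> E"
    using no_five_points [of "x + y" x "x + z + u" u "u + s"]
      no_five_points [of "x + y" y "y + z + v" v "v + s"] E W assms(8-10)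
    by (auto simp: bit_vec_ac)
  \<comment> \<open>The shift \<open>0\<close> occurs because \<open>z + (y + v)\<close> is itself
    in \<open>E\<close>.\<close>
  moreover have "\<not> (x + u \<in> E \<and> y + v \<in> E \<and> x + y + u + v \<in> E)"
    using no_five_points [of "x + u" z "y + v" 0 "u + (v + s)"] E W zero_mem
    by (auto simp: bit_vec_ac)
  moreover have "u \<notin> E" "v \<notin> E" "u + v \<notin> E"
    using assms(8-10) W disjnt by auto
  ultimately show False
    using claw [of x z "x + z + u"] claw [of y z "y + z + v"]
      claw [of "x + y" "x + z + u" "y + z + v"] E
    by (auto simp: bit_vec_ac)
qed

section \<open>Codimension of a subspace whose other cosets all meet \<open>E\<close>\<close>

lemma no_three_dim_quotient:
  assumes W: "vec.subspace W" and V: "vec.subspace V" "W \<subseteq> V"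
    and meets: "\<And>p. p \<in> V \<Longrightarrow> p \<notin> W \<Longrightarrow> \<exists>w\<in>W. p + w \<in> E"
  shows "vec.dim V \<le> vec.dim W + 2"
proof (rule ccontr)
  assume "\<not> ?thesis"
  then have dim: "vec.dim W + 2 < vec.dim V"
    by simp
  have ex: "\<exists>p. p \<in> V \<and> p \<notin> vec.span S" if "vec.dim S < vec.dim V" for S
    using that vec.dim_subset [of V "vec.span S"] by (force simp: vec.dim_span)
  \<comment> \<open>The vectors \<open>a\<close>, \<open>b\<close>, \<open>c\<close> are independent
    modulo \<open>W\<close>: before each choice the span has dimension at most
    \<open>vec.dim W + 2\<close>, less than that of \<open>V\<close>.\<close>
  obtain a where a: "a \<in> V" "a \<notin> vec.span W"
    using ex [of W] dim by auto
  obtain b where b: "b \<in> V" "b \<notin> vec.span (insert a W)"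
    using ex [of "insert a W"] dim a vec.dim_insert [of a W] by auto
  obtain c where c: "c \<in> V" "c \<notin> vec.span (insert b (insert a W))"
    using ex [of "insert b (insert a W)"] dim a b vec.dim_insert [of a W]
      vec.dim_insert [of b "insert a W"] by auto
  define S where "S = vec.span (insert b (insert a W))"
  have S: "vec.subspace S" "W \<subseteq> S" "a \<in> S" "b \<in> S"
    unfolding S_def by (auto intro: vec.span_base)
  have Wa: "vec.subspace (vec.span (insert a W))" "W \<subseteq> vec.span (insert a W)" "a \<in> vec.span (insert a W)"
    by (auto intro: vec.span_base)
  have shift: "p + q \<notin> T" if "vec.subspace T" "p \<in> T" "q \<notin> T" for p q T
    using that vec.subspace_diff [of T "p + q" p] by auto
  have aW: "a \<notin> W"
    using a by (auto intro: vec.span_base)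
  obtain w where w: "w \<in> W" "a + w \<in> E"
    using meets a aW by blast
  obtain w' where w': "w' \<in> W" "b + w' \<in> E"
    using meets [of b] b Wa by blast
  have "a + b \<notin> W"
    using shift [OF Wa(1) Wa(3) b(2)] Wa(2) by blast
  then obtain w'' where w'': "w'' \<in> W" "a + b + w'' \<in> E"
    using meets [of "a + b"] a b V vec.subspace_add by blast
  \<comment> \<open>This shift makes \<open>(a + w) + (b + w') + r\<close> equal to
    \<open>a + b + w''\<close>, as \<open>line_in_cosets\<close> needs.\<close>
  define r where "r = w + w' + w''"
  have r: "r \<in> W"
    using w w' w'' add_mem by (auto simp: r_def)
  have "(a + w) + (b + w') + r \<in> E"
    using w'' by (simp add: r_def bit_vec_ac)
  then have "(a + w) + (b + w') \<in> E \<or> (a + w) + r \<in> E \<or> (b + w') + r \<in> E"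
    using line_in_cosets w w' r by blast
  then obtain x y where xy: "x \<in> E" "y \<in> E" "x + y \<in> E" "x \<in> S" "y \<in> S"
  proof (elim disjE)
    assume "(a + w) + (b + w') \<in> E"
    with that [of "a + w" "b + w'"] w w' S show thesis
      by (auto intro!: vec.subspace_add)
  next
    assume *: "(a + w) + r \<in> E"
    have "((a + w) + r) + (b + w') \<in> E"
      using w'' by (simp add: r_def bit_vec_ac)
    with * that [of "(a + w) + r" "b + w'"] w w' r S show thesis
      by (auto intro!: vec.subspace_add)
  next
    assume *: "(b + w') + r \<in> E"
    have "(a + w) + ((b + w') + r) \<in> E"
      using w'' by (simp add: r_def bit_vec_ac)
    with * that [of "a + w" "(b + w') + r"] w w' r S show thesis
      by (auto intro!: vec.subspace_add)
  qed
  have SV: "S \<subseteq> V"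
    unfolding S_def using a b V by (intro vec.span_minimal) auto
  \<comment> \<open>Since \<open>c\<close> lies outside \<open>S\<close>, so does
    \<open>p + c\<close>; hence its coset is not \<open>W\<close>.\<close>
  have coset: "\<exists>u\<in>W. p + c + u \<in> E" if "p \<in> S" for p
    using meets [of "p + c"] shift [OF S(1) that, of c] c S SV V that vec.subspace_add
    unfolding S_def by blast
  obtain t where t: "t \<in> W" "c + t \<in> E"
    using coset [of 0] vec.subspace_0 [OF S(1)] by auto
  \<comment> \<open>The base point moves to \<open>c + t\<close>, a point of \<open>E\<close> that
    serves as \<open>z\<close> in \<open>no_transversal\<close>.\<close>
  have coset': "\<exists>u\<in>W. p + (c + t) + u \<in> E" if p: "p \<in> S" for p
  proof -
    obtain u where "u \<in> W" "p + c + u \<in> E"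
      using coset p by blast
    moreover have "p + (c + t) + (t + u) = p + c + u"
      by (simp add: bit_vec_ac)
    ultimately show ?thesis
      using t(1) add_mem by metis
  qed
  have "x + y \<in> S"
    using xy S vec.subspace_add by blast
  with xy(4,5) obtain u v s where "u \<in> W" "v \<in> W" "s \<in> W"
    and "x + (c + t) + u \<in> E" "y + (c + t) + v \<in> E" "x + y + (c + t) + s \<in> E"
    using coset' by metis
  then show False
    using no_transversal [OF xy(1-3) t(2)] by blast
qed

end

section \<open>Induced restrictions from explicit vectors\<close>

text \<open>With \<open>g i\<close> as images of the unit vectors, linearity is automatic and
  injectivity is triviality of the kernel, so only a finite check on nonzero coordinate vectors
  remains.\<close>

lemma contains_induced_restrictionI:
  fixes g :: "'m::finite \<Rightarrow> bit ^ 'n::finite" and V E :: "(bit ^ 'n) set"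
  defines "\<phi> \<equiv> \<lambda>v. \<Sum>i\<in>UNIV. v $ i *s g i"
  assumes "vec.subspace V" "range g \<subseteq> V" "F \<subseteq> UNIV - {0}"
    and "\<And>v. v \<noteq> 0 \<Longrightarrow> \<phi> v \<noteq> 0" and "\<And>v. v \<noteq> 0 \<Longrightarrow> \<phi> v \<in> E \<longleftrightarrow> v \<in> F"
  shows "contains_induced_restriction (E, V - {0}) (F, UNIV - {0})"
proof -
  have lin: "Vector_Spaces.linear (*s) (*s) \<phi>"
    unfolding \<phi>_def
    by unfold_locales (simp_all only: vector_add_component vector_smult_component
      vec.scale_left_distrib vec.scale_sum_right vec.scale_scale sum.distrib)
  have "inj \<phi>"
    using assms(5) vec.linear_inj_iff_eq_0 [OF lin] by blast
  moreover have "\<phi> v \<in> V" for v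
    unfolding \<phi>_def using assms(2,3)
    by (intro vec.subspace_sum vec.subspace_scale) auto
  moreover have "\<phi> ` F = E \<inter> \<phi> ` (UNIV - {0})"
    using assms(4,6) by blast
  ultimately show ?thesis
    unfolding contains_induced_restriction_def
    using lin assms(5) by (auto intro!: exI [of _ \<phi>] dest: injD intro: inj_on_subset)
qed

lemma contains_I3I:
  fixes V E :: "(bit ^ 'n::finite) set"
  assumes V: "vec.subspace V" "E \<subseteq> V - {0}"
    and E: "x \<in> E" "y \<in> E" "z \<in> E" "x + y \<notin> E" "x + z \<notin> E" "y + z \<notin> E" "x + y + z \<notin> E"
  shows "contains_induced_restriction (E, V - {0}) I3"
proof -
  define g :: "3 \<Rightarrow> bit ^ 'n" where "g = (\<lambda>i. if i = 1 then x else if i = 2 then y else z)"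
  \<comment> \<open>Independence is forced: if two of the vectors coincided, the triple sum would be
    the third, in \<open>E\<close>; and \<open>x + y = z\<close> would put \<open>x + y\<close> in
    \<open>E\<close>. The reordered sums expose the coinciding pair.\<close>
  have sums: "x + z + y \<notin> E" "y + z + x \<notin> E"
    using E by (simp_all add: bit_vec_ac)
  have nz: "x \<noteq> 0" "y \<noteq> 0" "z \<noteq> 0" "x + y \<noteq> 0" "x + z \<noteq> 0" "y + z \<noteq> 0" "x + y + z \<noteq> 0"
    using V E sums bit_vec_add_eq_0_iff [of "x + y" z] by auto
  have "(\<Sum>i\<in>UNIV. v $ i *s g i) \<noteq> 0 \<and>
      ((\<Sum>i\<in>UNIV. v $ i *s g i) \<in> E \<longleftrightarrow> v \<in> range (\<lambda>i. axis i 1))" if "v \<noteq> 0" for v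
  proof -
    have "v $ 1 \<noteq> 0 \<or> v $ 2 \<noteq> 0 \<or> v $ 3 \<noteq> 0"
      using that by (simp add: vec_eq_iff forall_3)
    moreover have "v \<in> range (\<lambda>i. axis i 1) \<longleftrightarrow>
        (v $ 1, v $ 2, v $ 3) \<in> {(1, 0, 0), (0, 1, 0), (0, 0, 1)}"
      unfolding UNIV_3 image_insert image_empty insert_iff vec_eq_iff forall_3 axis_def vec_lambda_beta
      by simp
    ultimately show ?thesis
      using E nz
      by (cases "v $ 1"; cases "v $ 2"; cases "v $ 3") (simp_all add: sum_3 g_def)
  qed
  then show ?thesis
    unfolding I3_def using V E
    by (intro contains_induced_restrictionI [where g = g]) (auto simp: g_def axis_eq_0_iff)
qed

lemma contains_F7I:
  fixes V E :: "(bit ^ 'n::finite) set"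
  assumes V: "vec.subspace V" "E \<subseteq> V - {0}"
    and E: "x \<in> E" "y \<in> E" "z \<in> E" "x + y \<in> E" "x + z \<in> E" "y + z \<in> E" "x + y + z \<in> E"
  shows "contains_induced_restriction (E, V - {0}) F7"
proof -
  define g :: "3 \<Rightarrow> bit ^ 'n" where "g = (\<lambda>i. if i = 1 then x else if i = 2 then y else z)"
  have "(\<Sum>i\<in>UNIV. v $ i *s g i) \<in> E" if "v \<noteq> 0" for v
  proof -
    have "v $ 1 \<noteq> 0 \<or> v $ 2 \<noteq> 0 \<or> v $ 3 \<noteq> 0"
      using that by (simp add: vec_eq_iff forall_3)
    then show ?thesis
      using E by (cases "v $ 1"; cases "v $ 2"; cases "v $ 3") (simp_all add: sum_3 g_def)
  qed
  then show ?thesis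
    unfolding F7_def using V E
    by (intro contains_induced_restrictionI [where g = g]) (auto simp: g_def)
qed

lemma contains_K5I:
  fixes V E :: "(bit ^ 'n::finite) set"
  assumes V: "vec.subspace V" "E \<subseteq> V - {0}"
    and E: "w \<in> E" "x \<in> E" "y \<in> E" "z \<in> E" "w + x \<in> E" "w + y \<in> E" "w + z \<in> E"
      "x + y \<in> E" "x + z \<in> E" "y + z \<in> E"
    and N: "w + x + y \<notin> E" "w + x + z \<notin> E" "w + y + z \<notin> E" "x + y + z \<notin> E" "w + x + y + z \<notin> E"
  shows "contains_induced_restriction (E, V - {0}) K5"
proof -
  define g :: "4 \<Rightarrow> bit ^ 'n"
    where "g = (\<lambda>i. if i = 1 then w else if i = 2 then x else if i = 3 then y else z)"
  have nz: "p \<noteq> 0" if "p \<in> E" for p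
    using V that by auto
  have sums: "w + x + z + y \<notin> E" "w + y + z + x \<notin> E" "x + y + z + w \<notin> E"
    using N by (simp_all add: bit_vec_ac)
  \<comment> \<open>A vanishing triple sum would make the sum of all four equal to the remaining
    vector, in \<open>E\<close>; if the sum of all four vanished, \<open>w + x + y\<close> would be
    \<open>z\<close>.\<close>
  have nz': "w + x + y \<noteq> 0" "w + x + z \<noteq> 0" "w + y + z \<noteq> 0" "x + y + z \<noteq> 0" "w + x + y + z \<noteq> 0"
    using E N sums bit_vec_add_eq_0_iff [of "w + x + y" z] by auto
  \<comment> \<open>As a sum, the weight can be evaluated coordinate by coordinate with
    \<open>sum_4\<close>.\<close>
  have card: "hamming_weight v = (\<Sum>i\<in>UNIV. if v $ i \<noteq> 0 then 1 else 0)" for v :: "bit ^ 4"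
    by (simp add: hamming_weight_def sum.If_cases)
  have "(\<Sum>i\<in>UNIV. v $ i *s g i) \<noteq> 0 \<and>
      ((\<Sum>i\<in>UNIV. v $ i *s g i) \<in> E \<longleftrightarrow> hamming_weight v = 1 \<or> hamming_weight v = 2)"
    if "v \<noteq> 0" for v
  proof -
    have "v $ 1 \<noteq> 0 \<or> v $ 2 \<noteq> 0 \<or> v $ 3 \<noteq> 0 \<or> v $ 4 \<noteq> 0"
      using that by (simp add: vec_eq_iff forall_4)
    then show ?thesis
      using E N nz' E [THEN nz]
      by (cases "v $ 1"; cases "v $ 2"; cases "v $ 3"; cases "v $ 4") (simp_all add: sum_4 g_def card)
  qed
  then show ?thesis
    unfolding K5_def using V E
    by (intro contains_induced_restrictionI [where g = g]) (auto simp: g_def hamming_weight_def)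
qed

section \<open>The bound on the critical number\<close>

theorem theorem1p1:
  fixes M :: "'n::finite matroid"
  assumes "simple_binary_matroid M"
    and "\<not> contains_induced_restriction M I3"
    and "\<not> contains_induced_restriction M F7"
    and "\<not> contains_induced_restriction M K5"
  shows "critical_number M \<le> 2"
proof -
  obtain E V where V: "vec.subspace V" "E \<subseteq> V - {0}" and M: "M = (E, V - {0})"
    using assms(1) by (auto simp: simple_binary_matroid_def flat_def split: prod.splits)
  define P where "P W \<longleftrightarrow> vec.subspace W \<and> W \<subseteq> V \<and> W \<inter> E = {}" for W
  have "P {0}"
    using V vec.subspace_0 by (auto simp: P_def)
  moreover have "vec.dim W \<le> vec.dim V" if "P W" for W
    using that by (simp add: P_def vec.dim_subset)
  ultimately obtain W where PW: "P W" and max: "\<And>U. P U \<Longrightarrow> vec.dim U \<le> vec.dim W"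
    using ex_has_greatest_nat [of P "{0}" vec.dim "Suc (vec.dim V)"] by (auto simp: less_Suc_eq_le)
  then have W: "vec.subspace W" "W \<subseteq> V" "W \<inter> E = {}"
    by (auto simp: P_def)
  \<comment> \<open>Over the two-element field, adjoining \<open>p\<close> to \<open>W\<close> adds
    only the coset of \<open>p\<close>. If that coset avoided \<open>E\<close>, the larger span
    would contradict maximality.\<close>
  have meets: "\<exists>w\<in>W. p + w \<in> E" if p: "p \<in> V" "p \<notin> W" for p
  proof (rule ccontr)
    assume N: "\<not> ?thesis"
    have span: "vec.span W = W"
      using W vec.span_eq_iff by blast
    have "q \<notin> E" if q: "q \<in> vec.span (insert p W)" for q
    proof -
      obtain k where k: "q - k *s p \<in> W"
        using q span by (auto simp: vec.span_insert)
      have "q = k *s p + (q - k *s p)"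
        by simp
      with k W N show ?thesis
        by (cases k) (simp, metis disjoint_iff, metis vec.scale_one)
    qed
    moreover have "vec.span (insert p W) \<subseteq> V"
      using p V W by (intro vec.span_minimal) auto
    ultimately have "P (vec.span (insert p W))"
      by (auto simp: P_def)
    from max [OF this] show False
      using p span by (simp add: vec.dim_span vec.dim_insert)
  qed
  interpret zero_flat E W
  proof
    show "x + y \<in> E \<or> x + z \<in> E \<or> y + z \<in> E \<or> x + y + z \<in> E" if "x \<in> E" "y \<in> E" "z \<in> E" for x y z
      using contains_I3I [OF V that] assms(2) M by blast
    show "x + y + z \<notin> E"
      if "x \<in> E" "y \<in> E" "z \<in> E" "x + y \<in> E" "x + z \<in> E" "y + z \<in> E" for x y z
      using contains_F7I [OF V that] assms(3) M by blast
    show "w + x + y \<in> E \<or> w + x + z \<in> E \<or> w + y + z \<in> E \<or> x + y + z \<in> E \<or> w + x + y + z \<in> E"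
      if "w \<in> E" "x \<in> E" "y \<in> E" "z \<in> E" "w + x \<in> E" "w + y \<in> E" "w + z \<in> E"
        "x + y \<in> E" "x + z \<in> E" "y + z \<in> E" for w x y z
      using contains_K5I [OF V that] assms(4) M by blast
  qed (use W vec.subspace_0 vec.subspace_add in auto)
  define k where "k = vec.dim V - vec.dim W"
  have k: "k \<le> 2" "vec.dim W + k = vec.dim V"
    using no_three_dim_quotient [OF W(1) V(1) W(2) meets] vec.dim_subset [OF W(2)]
    by (auto simp: k_def)
  have "insert 0 (U - {0}) = U" if "vec.subspace U" for U :: "(bit ^ 'n) set"
    using vec.subspace_0 [OF that] by auto
  \<comment> \<open>The flat \<open>W - {0}\<close> shows that the codimension \<open>k\<close> of
    \<open>W\<close> is admissible.\<close>
  then have "\<exists>F. flat F \<and> F \<subseteq> V - {0} - E \<and> flat_dim F + k = matroid_dim M"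
    using W V k by (intro exI [of _ "W - {0}"]) (auto simp: flat_def flat_dim_def matroid_dim_def M)
  then have "critical_number M \<le> k"
    unfolding critical_number_def M by (auto intro!: Least_le)
  with k(1) show ?thesis
    by simp
qed

end
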